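(* There is a kernel $\kappa$ from $S\times S$ to $G$ such that $$\int f(gs,g)\,\lambda(dg)=\iint f(t,g)\,\kappa_{s,t}(dg)\,\mu_s(dt)$$ for all $s\in S$ and all measurable $f:S\times G\to[0,\infty]$, and moreover: (i) $\kappa_{s,gt}=\kappa_{s,t}\circ\theta_g^{-1}$ for all $g\in G$, $s,t\in S$, where $\theta_g(h)=gh$; (ii) $\kappa_{s,t}$ is concentrated on $G_{s,t}:=\{g\in G:gs=t\}$ for all $s\in S$, $t\in Gs$; (iii) $\kappa_{s,t}(G)=1$ for all $s\in S$, $t\in Gs$.
   Context: $G$ is a locally compact second countable Hausdorff group with Borel $\sigma$-field and fixed left Haar measure $\lambda$. $(S,\mathcal S)$ is a Borel space on which $G$ acts measurably. For $s\in S$, $\mu_s$ is the image of $\lambda$ under $g\mapsto gs$. The action is proper: there exists a measurable partition $B_1,B_2,\dots$ of $S$ with $\mu_s(B_n)<\infty$ for all $s\in S$, $n\in\mathbb N$. A kernel from $S\times S$ to $G$ is a map $\kappa$ with $(s,t)\mapsto\kappa_{s,t}(A)$ measurable for each Borel $A\subseteq G$ and each $\kappa_{s,t}$ a measure. *)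

theory Defs
  imports "HOL-Analysis.Analysis"
begin

text \<open>The group G is modelled by a type 'g carrying a (not necessarily commutative)
  topological group structure, written additively: g + h is the group product,
  0 the identity, - g the inverse.  The left translation theta_g is (+) g.\<close>

definition left_haar_measure :: "'g::topological_group_add measure \<Rightarrow> bool" where
  "left_haar_measure lam \<longleftrightarrow>
     sets lam = sets borel \<and>
     (\<forall>K. compact K \<longrightarrow> emeasure lam K < \<infinity>) \<and>
     (\<forall>U. open U \<and> U \<noteq> {} \<longrightarrow> emeasure lam U > 0) \<and>
     (\<forall>g. distr lam borel (\<lambda>h. g + h) = lam)"

definition borel_space_iso :: "'s measure \<Rightarrow> bool" where
  "borel_space_iso S \<longleftrightarrow>
     (\<exists>(B::real set) f h. B \<in> sets borel \<and> B \<subseteq> {0..1} \<and>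
        f \<in> S \<rightarrow>\<^sub>M restrict_space borel B \<and> h \<in> restrict_space borel B \<rightarrow>\<^sub>M S \<and>
        (\<forall>x\<in>space S. h (f x) = x) \<and> (\<forall>y\<in>B. f (h y) = y))"

definition measurable_action :: "('g::topological_group_add \<Rightarrow> 's \<Rightarrow> 's) \<Rightarrow> 's measure \<Rightarrow> bool" where
  "measurable_action act S \<longleftrightarrow>
     (\<forall>g. \<forall>s\<in>space S. act g s \<in> space S) \<and>
     (\<forall>s\<in>space S. act 0 s = s) \<and>
     (\<forall>g h. \<forall>s\<in>space S. act (g + h) s = act g (act h s)) \<and>
     (\<lambda>(g, s). act g s) \<in> (borel \<Otimes>\<^sub>M S) \<rightarrow>\<^sub>M S"

definition orbit_measure :: "'g measure \<Rightarrow> ('g \<Rightarrow> 's \<Rightarrow> 's) \<Rightarrow> 's measure \<Rightarrow> 's \<Rightarrow> 's measure" where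
  "orbit_measure lam act S s = distr lam S (\<lambda>g. act g s)"

definition proper_action :: "'g measure \<Rightarrow> ('g \<Rightarrow> 's \<Rightarrow> 's) \<Rightarrow> 's measure \<Rightarrow> bool" where
  "proper_action lam act S \<longleftrightarrow>
     (\<exists>B :: nat \<Rightarrow> 's set. (\<forall>n. B n \<in> sets S) \<and> disjoint_family B \<and>
        (\<Union>n. B n) = space S \<and>
        (\<forall>s\<in>space S. \<forall>n. emeasure (orbit_measure lam act S s) (B n) < \<infinity>))"

definition is_kernel :: "'s measure \<Rightarrow> ('s \<Rightarrow> 's \<Rightarrow> 'g::topological_space measure) \<Rightarrow> bool" where
  "is_kernel S \<kappa> \<longleftrightarrow>
     (\<forall>s t. sets (\<kappa> s t) = sets (borel :: 'g measure)) \<and>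
     (\<forall>A \<in> sets (borel :: 'g measure).
        (\<lambda>(s, t). emeasure (\<kappa> s t) A) \<in> borel_measurable (S \<Otimes>\<^sub>M S))"

end

theory Submission
  imports Defs
begin

text \<open>It suffices to find a measurable \<open>\<gamma> : S \<times> S \<rightarrow> G\<close> with \<open>\<gamma>(s,t) s = t\<close> for \<open>t \<in> G s\<close>. Given
  such a \<open>\<gamma>\<close>, let \<open>n(t)\<close> be the least \<open>n\<close> with \<open>\<mu>\<^sub>t(B\<^sub>n) > 0\<close> and let \<open>\<kappa>\<^sub>s\<^sub>,\<^sub>t\<close> be the law of
  \<open>h\<^sup>-\<^sup>1 \<gamma>(s, h t)\<close> when \<open>h\<close> has distribution \<open>\<lambda>\<close> conditioned on \<open>h t \<in> B\<^bsub>n(t)\<^esub>\<close>. Uniqueness of Haar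
  measure makes right translates of \<open>\<lambda>\<close> multiples of \<open>\<lambda>\<close>, whence \<open>n\<close> is invariant and \<open>\<kappa>\<close> is
  equivariant. Stabilizers preserve some \<open>\<mu>\<^sub>s(B\<^sub>n) \<in> (0,\<infinity>)\<close>, so \<open>\<lambda>\<close> is right invariant
  under them; together with equivariance and Fubini this gives the disintegration formula.

  To obtain \<open>\<gamma>\<close>, one constructs countably many measurable real functions on \<open>S\<close> that separate points
  and are continuous along orbits. Then \<open>t \<in> C s\<close> is a measurable condition on \<open>(s,t)\<close> for every
  compact \<open>C\<close>, the sets \<open>G\<^sub>s\<^sub>,\<^sub>t\<close> are closed, and a measurable selection exists.\<close>

section \<open>Locally compact second countable spaces\<close>

text \<open>Cantor's intersection theorem. It supplies the selected points in the selection argument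
  and later turns approximate hits of a compact set into an exact one.\<close>

lemma compact_decseq_Inter_nonempty:
  fixes D :: "nat \<Rightarrow> 'a::t2_space set"
  assumes "\<And>n. compact (D n)" "\<And>n. D n \<noteq> {}" "decseq D"
  shows "(\<Inter>n. D n) \<noteq> {}"
proof
  assume "(\<Inter>n. D n) = {}"
  then have cov: "D 0 \<subseteq> (\<Union>n. - D n)" by blast
  obtain I where I: "finite I" "D 0 \<subseteq> (\<Union>n\<in>I. - D n)"
    using compactE_image[OF assms(1)[of 0] _ cov] assms(1)
    by (metis compact_imp_closed open_Compl)
  \<comment> \<open>Inserting \<open>0\<close> makes the maximum exist when \<open>I\<close> is
    empty and puts the point chosen below into \<open>D 0\<close>, the set that is covered.\<close>
  define N where "N = Max (insert 0 I)"
  obtain x where x: "x \<in> D N" using assms(2) by blast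
  then have "x \<in> D n" if "n \<in> insert 0 I" for n
    using I(1) that decseqD[OF assms(3), of n N] unfolding N_def by auto
  with I(2) show False by blast
qed

lemma Hausdorff_space_euclidean_t2: "Hausdorff_space (euclidean :: 'a::t2_space topology)"
  unfolding Hausdorff_space_def disjnt_def open_openin[symmetric] topspace_euclidean
  using hausdorff by metis

text \<open>The members with compact closure of a countable base still form a base: inside a compact
  neighbourhood \<open>K\<close> of \<open>x\<close> there is a basic neighbourhood, and its closure
  stays in \<open>K\<close> because compact sets are closed in a Hausdorff space.\<close>

lemma locally_compact_base:
  assumes lc: "locally_compact_space (euclidean :: 'g topology)"
  obtains U :: "nat \<Rightarrow> 'g::{t2_space, second_countable_topology} set" where "\<And>n. open (U n)" "\<And>n. compact (closure (U n))"
    "\<And>W x. open W \<Longrightarrow> x \<in> W \<Longrightarrow> \<exists>n. x \<in> U n \<and> closure (U n) \<subseteq> W"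
proof -
  obtain B :: "'g set set" where B: "countable B" "topological_basis B"
    using ex_countable_basis by blast
  define B' where "B' = {b \<in> B. compact (closure b)}"
  have nb: "\<exists>b\<in>B'. x \<in> b \<and> closure b \<subseteq> W" if W: "open W" "x \<in> W" for W x
  proof -
    have "neighbourhood_base_of (compactin euclidean) (euclidean :: 'g topology)"
      using lc locally_compact_space_neighbourhood_base Hausdorff_space_euclidean_t2 by blast
    then obtain V K where VK: "open V" "compact K" "x \<in> V" "V \<subseteq> K" "K \<subseteq> W"
      unfolding neighbourhood_base_of compactin_euclidean_iff open_openin[symmetric]
      using W by metis
    obtain b where b: "b \<in> B" "x \<in> b" "b \<subseteq> V"
      using topological_basisE[OF B(2) VK(1,3)] by blast
    have "closure b \<subseteq> K"
      using b VK by (meson closure_minimal compact_imp_closed subset_trans)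
    then show ?thesis
      using b VK unfolding B'_def
      by (metis (mono_tags, lifting) closed_closure compact_Int_closed inf.absorb_iff2 mem_Collect_eq subset_trans)
  qed
  have ne: "B' \<noteq> {}" using nb[of UNIV] by auto
  have cB': "countable B'" using B(1) unfolding B'_def by (auto intro: countable_subset)
  show thesis
  proof (rule that[of "from_nat_into B'"])
    fix n show "open (from_nat_into B' n)" "compact (closure (from_nat_into B' n))"
      using from_nat_into[OF ne, of n] topological_basis_open[OF B(2)] unfolding B'_def by auto
  next
    fix W :: "'g set" and x assume "open W" "x \<in> W"
    from nb[OF this] show "\<exists>n. x \<in> from_nat_into B' n \<and> closure (from_nat_into B' n) \<subseteq> W"
      by (metis cB' from_nat_into_surj)
  qed
qed

text \<open>Intersecting a compact part of \<open>\<Phi> x\<close> successively with those members of a base of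
  compact sets that it meets shrinks it to a single point.\<close>

lemma measurable_selector:
  fixes \<Phi> :: "'a \<Rightarrow> 'g::{t2_space, second_countable_topology} set"
  assumes lc: "locally_compact_space (euclidean :: 'g topology)"
    and closed: "\<And>x. x \<in> space M \<Longrightarrow> closed (\<Phi> x)"
    and meas: "\<And>C. compact C \<Longrightarrow> {x \<in> space M. \<Phi> x \<inter> C \<noteq> {}} \<in> sets M"
  obtains \<gamma> where "\<gamma> \<in> M \<rightarrow>\<^sub>M borel" "\<And>x. x \<in> space M \<Longrightarrow> \<Phi> x \<noteq> {} \<Longrightarrow> \<gamma> x \<in> \<Phi> x"
proof -
  obtain U :: "nat \<Rightarrow> 'g set" where U: "\<And>n. open (U n)" "\<And>n. compact (closure (U n))"
    "\<And>W x. open W \<Longrightarrow> x \<in> W \<Longrightarrow> \<exists>n. x \<in> U n \<and> closure (U n) \<subseteq> W"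
    using locally_compact_base[OF lc] by blast
  define V where "V n = closure (U n)" for n
  have cV: "compact (V n)" for n using U(2) by (simp add: V_def)
  have V_cov: "\<exists>n. x \<in> V n" for x
    using U(3)[of UNIV x] closure_subset unfolding V_def by blast
  have V_sep: "\<exists>n. x \<in> V n \<and> y \<notin> V n" if "x \<noteq> y" for x y
    using U(3)[of "-{y}" x] that closure_subset unfolding V_def by blast
  define H where "H x = (LEAST n. \<Phi> x \<inter> V n \<noteq> {})" for x
  \<comment> \<open>\<open>D x n\<close> depends on \<open>x\<close> only through which of countably
    many compact sets \<open>\<Phi> x\<close> meets. The measurability induction below rests on
    this.\<close>
  define D where
    "D x = rec_nat (V (H x)) (\<lambda>n A. if \<Phi> x \<inter> (A \<inter> V n) \<noteq> {} then A \<inter> V n else A)" for x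
  have D0: "D x 0 = V (H x)" and
    DS: "D x (Suc n) = (if \<Phi> x \<inter> (D x n \<inter> V n) \<noteq> {} then D x n \<inter> V n else D x n)" for x n
    by (auto simp: D_def)
  have cD: "compact (D x n)" for x n
    by (induction n) (auto simp: D0 DS cV intro!: compact_Int)
  have D_ne: "\<Phi> x \<inter> D x n \<noteq> {}" if ne: "\<Phi> x \<noteq> {}" for x n
  proof (induction n)
    case 0
    obtain n where "\<Phi> x \<inter> V n \<noteq> {}" using ne V_cov by blast
    then show ?case unfolding D0 H_def by (rule LeastI)
  qed (auto simp: DS)
  have D_dec: "decseq (\<lambda>n. \<Phi> x \<inter> D x n \<inter> F)" for x F
    by (rule decseq_SucI) (auto simp: DS)
  have D_meet: "(\<Inter>n. \<Phi> x \<inter> D x n \<inter> F) \<noteq> {}"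
    if "x \<in> space M" "closed F" "\<And>n. \<Phi> x \<inter> D x n \<inter> F \<noteq> {}" for x F
    by (rule compact_decseq_Inter_nonempty)
      (use that D_dec closed cD in \<open>auto simp: compact_Int_closed closed_Int_compact\<close>)
  \<comment> \<open>If \<open>V n\<close> contains \<open>y\<close> but not \<open>z\<close>, then
    \<open>y\<close> witnesses that \<open>V n\<close> is kept at stage \<open>n\<close>, and this
    expels \<open>z\<close> from \<open>D x (Suc n)\<close>.\<close>
  have D_uniq: "y = z" if "\<forall>n. y \<in> \<Phi> x \<inter> D x n" "\<forall>n. z \<in> \<Phi> x \<inter> D x n" for x y z
  proof (rule ccontr)
    assume "y \<noteq> z"
    then obtain n where "y \<in> V n" "z \<notin> V n" using V_sep by blast
    then show False using that[rule_format, of n] that[rule_format, of "Suc n"]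
      by (auto simp: DS split: if_splits)
  qed
  \<comment> \<open>On points with empty \<open>\<Phi> x\<close> the selector has one constant
    value, so only the measurability of that set of points matters there.\<close>
  define \<gamma> where "\<gamma> x = (if \<Phi> x \<noteq> {} then THE y. \<forall>n. y \<in> \<Phi> x \<inter> D x n else undefined)" for x
  have \<gamma>: "\<forall>n. \<gamma> x \<in> \<Phi> x \<inter> D x n" if x: "x \<in> space M" "\<Phi> x \<noteq> {}" for x
  proof -
    obtain y where y: "\<forall>n. y \<in> \<Phi> x \<inter> D x n"
      using D_meet[OF x(1) closed_UNIV] D_ne[OF x(2)] by auto
    have "\<forall>n. (THE y. \<forall>n. y \<in> \<Phi> x \<inter> D x n) \<in> \<Phi> x \<inter> D x n"
      by (rule theI[of _ y]) (use y D_uniq in blast)+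
    then show ?thesis using that by (simp add: \<gamma>_def)
  qed
  \<comment> \<open>The closed set \<open>F\<close> is left general because the induction step
    absorbs \<open>V n\<close> into it. The base case splits according to the value of
    \<open>H x\<close>.\<close>
  have meet_meas: "{x \<in> space M. \<Phi> x \<inter> D x n \<inter> F \<noteq> {}} \<in> sets M" if "closed F" for n F
    using that
  proof (induction n arbitrary: F)
    case 0
    have "{x \<in> space M. \<Phi> x \<inter> D x 0 \<inter> F \<noteq> {}} =
      (\<Union>m. ({x \<in> space M. \<Phi> x \<inter> V m \<noteq> {}} - (\<Union>k<m. {x \<in> space M. \<Phi> x \<inter> V k \<noteq> {}})) \<inter>
          {x \<in> space M. \<Phi> x \<inter> (V m \<inter> F) \<noteq> {}})" (is "?L = ?R")
    proof (intro equalityI subsetI)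
      fix x assume x: "x \<in> ?L"
      have "\<Phi> x \<inter> V (H x) \<noteq> {}" using x by (auto simp: D0)
      moreover have "\<not> \<Phi> x \<inter> V k \<noteq> {}" if "k < H x" for k
        using not_less_Least that unfolding H_def by blast
      ultimately show "x \<in> ?R" using x by (auto simp: D0 intro!: exI[of _ "H x"])
    next
      fix x assume "x \<in> ?R"
      then obtain m where m: "x \<in> space M" "\<Phi> x \<inter> V m \<noteq> {}" "\<forall>k<m. \<not> \<Phi> x \<inter> V k \<noteq> {}"
        "\<Phi> x \<inter> (V m \<inter> F) \<noteq> {}" by auto
      have "H x = m" unfolding H_def
        by (rule Least_equality) (use m in \<open>auto simp: not_less[symmetric]\<close>)
      then show "x \<in> ?L" using m by (auto simp: D0)
    qed
    also have "\<dots> \<in> sets M"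
      by (intro sets.countable_UN sets.Int sets.Diff sets.finite_UN image_subsetI meas cV
          compact_Int_closed 0) auto
    finally show ?case .
  next
    case (Suc n)
    have "{x \<in> space M. \<Phi> x \<inter> D x (Suc n) \<inter> F \<noteq> {}} =
      {x \<in> space M. \<Phi> x \<inter> D x n \<inter> (V n \<inter> F) \<noteq> {}} \<union>
      ({x \<in> space M. \<Phi> x \<inter> D x n \<inter> F \<noteq> {}} - {x \<in> space M. \<Phi> x \<inter> D x n \<inter> V n \<noteq> {}})"
      by (auto simp: DS)
    also have "\<dots> \<in> sets M"
      by (intro sets.Un sets.Diff Suc.IH closed_Int Suc.prems compact_imp_closed[OF cV])
    finally show ?case .
  qed
  have ne_meas: "{x \<in> space M. \<Phi> x \<noteq> {}} \<in> sets M"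
  proof -
    have "{x \<in> space M. \<Phi> x \<noteq> {}} = (\<Union>n. {x \<in> space M. \<Phi> x \<inter> V n \<noteq> {}})"
      using V_cov by blast
    then show ?thesis using meas[OF cV] by auto
  qed
  have "\<gamma> -` F \<inter> space M \<in> sets M" if F: "closed F" for F
  proof -
    \<comment> \<open>By compactness, the limit point lies in \<open>F\<close> exactly when every
      stage meets \<open>F\<close>, so preimages of closed sets come from countably many hitting
      conditions.\<close>
    have \<gamma>_iff: "\<gamma> x \<in> F \<longleftrightarrow> (\<forall>n. \<Phi> x \<inter> D x n \<inter> F \<noteq> {})" if x: "x \<in> space M" "\<Phi> x \<noteq> {}" for x
    proof
      assume "\<forall>n. \<Phi> x \<inter> D x n \<inter> F \<noteq> {}"
      then obtain y where y: "\<forall>n. y \<in> \<Phi> x \<inter> D x n \<inter> F"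
        using D_meet[OF x(1) F] by blast
      then have "y = \<gamma> x" using D_uniq[of y x "\<gamma> x"] \<gamma>[OF x] by blast
      with y show "\<gamma> x \<in> F" by blast
    qed (use \<gamma>[OF x] in blast)
    then have "\<gamma> -` F \<inter> space M =
      (if undefined \<in> F then space M - {x \<in> space M. \<Phi> x \<noteq> {}} else {}) \<union>
      (\<Inter>n. {x \<in> space M. \<Phi> x \<inter> D x n \<inter> F \<noteq> {}})" (is "_ = ?R")
    proof (intro set_eqI)
      fix x show "x \<in> \<gamma> -` F \<inter> space M \<longleftrightarrow> x \<in> ?R"
      proof (cases "\<Phi> x = {}")
        case True
        then show ?thesis by (auto simp: \<gamma>_def)
      next
        case False
        then show ?thesis using \<gamma>_iff[OF _ False] by auto
      qed
    qed
    also have "\<dots> \<in> sets M"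
      using meet_meas[OF F] ne_meas by auto
    finally show ?thesis .
  qed
  then have "\<gamma> \<in> M \<rightarrow>\<^sub>M borel"
    unfolding borel_eq_closed by (intro measurable_measure_of) auto
  then show thesis using that \<gamma> by blast
qed

section \<open>Countable families of continuous functions that determine a measure\<close>

lemma sets_borel_eq_base:
  fixes U :: "nat \<Rightarrow> 'g::topological_space set"
  assumes U: "\<And>n. open (U n)" "\<And>W x. open W \<Longrightarrow> x \<in> W \<Longrightarrow> \<exists>n. x \<in> U n \<and> U n \<subseteq> W"
    and E: "range U \<subseteq> E" "\<And>X. X \<in> E \<Longrightarrow> open X"
  shows "sets borel = sigma_sets UNIV E"
proof -
  have "sigma_sets UNIV {S. open S} = sigma_sets UNIV E"
  proof (rule sigma_sets_eqI)
    fix W assume "W \<in> {S :: 'g set. open S}"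
    then have "W = (\<Union>n\<in>{n. U n \<subseteq> W}. U n)" using U(2) by blast
    also have "\<dots> \<in> sigma_sets UNIV E"
    proof -
      interpret sigma_algebra UNIV "sigma_sets UNIV E" by (rule sigma_algebra_sigma_sets) auto
      show ?thesis using E(1) by (intro countable_UN) auto
    qed
    finally show "W \<in> sigma_sets UNIV E" .
  qed (use E in auto)
  then show ?thesis by (simp add: borel_def)
qed

text \<open>For each finite intersection of base sets and each member of a compact exhaustion of it,
  take a Urysohn function between the two indicators. The integrals recover the measures of these
  intersections, which form an intersection-stable generator of the Borel sets.\<close>

lemma countable_determining_functions:
  assumes lc: "locally_compact_space (euclidean :: 'g topology)"
  obtains \<phi> :: "nat \<Rightarrow> 'g::{t2_space, second_countable_topology} \<Rightarrow> real" where
    "\<And>i. continuous_on UNIV (\<phi> i)" "\<And>i x. 0 \<le> \<phi> i x" "\<And>i x. \<phi> i x \<le> 1"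
    "\<And>i. \<exists>K. compact K \<and> (\<forall>x. x \<notin> K \<longrightarrow> \<phi> i x = 0)"
    "\<And>M N. sets M = sets borel \<Longrightarrow> sets N = sets borel \<Longrightarrow>
      (\<And>K. compact K \<Longrightarrow> emeasure M K < \<infinity>) \<Longrightarrow>
      (\<And>i. (\<integral>\<^sup>+ x. ennreal (\<phi> i x) \<partial>M) = (\<integral>\<^sup>+ x. ennreal (\<phi> i x) \<partial>N)) \<Longrightarrow> M = N"
proof -
  obtain U :: "nat \<Rightarrow> 'g set" where U: "\<And>n. open (U n)" "\<And>n. compact (closure (U n))"
    "\<And>W x. open W \<Longrightarrow> x \<in> W \<Longrightarrow> \<exists>n. x \<in> U n \<and> closure (U n) \<subseteq> W"
    using locally_compact_base[OF lc] by blast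
  \<comment> \<open>The separate index \<open>k\<close> keeps the set inside \<open>U k\<close>,
    which gives compact supports. The lists keep the family countable and closed under
    intersection.\<close>
  define Oset where "Oset k xs = U k \<inter> (\<Inter>i\<in>set xs. U i)" for k xs
  define C where "C k xs m = (\<Union>j\<in>{j. j \<le> m \<and> closure (U j) \<subseteq> Oset k xs}. closure (U j))" for k xs m
  have op: "open (Oset k xs)" for k xs
    unfolding Oset_def by (intro open_Int open_INT ballI U(1)) auto
  have cC: "compact (C k xs m)" for k xs m
    unfolding C_def by (intro compact_UN U(2)) auto
  have C_sub: "C k xs m \<subseteq> Oset k xs" for k xs m by (auto simp: C_def)
  have C_inc: "incseq (C k xs)" for k xs by (rule incseq_SucI) (auto simp: C_def intro: le_SucI)
  have C_UN: "(\<Union>m. C k xs m) = Oset k xs" for k xs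
  proof (intro equalityI subsetI)
    fix x assume "x \<in> Oset k xs"
    then obtain n where "x \<in> U n" "closure (U n) \<subseteq> Oset k xs" using U(3)[OF op] by blast
    then have "x \<in> C k xs n" using closure_subset by (auto simp: C_def)
    then show "x \<in> (\<Union>m. C k xs m)" by blast
  qed (use C_sub in blast)
  have "\<exists>f. continuous_on UNIV f \<and> (\<forall>x. 0 \<le> f x \<and> f x \<le> (1::real)) \<and>
      (\<forall>x\<in>C k xs m. f x = 1) \<and> (\<forall>x. x \<notin> Oset k xs \<longrightarrow> f x = 0)" for k xs m
  proof -
    have "regular_space (euclidean :: 'g topology)"
      using lc locally_compact_Hausdorff_imp_regular_space Hausdorff_space_euclidean_t2 by blast
    then have "completely_regular_space (euclidean :: 'g topology)"
      using lc completely_regular_eq_regular_space by blast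
    moreover have "compactin euclidean (C k xs m)" "closedin euclidean (- Oset k xs)"
      "disjnt (C k xs m) (- Oset k xs)"
      using cC op C_sub[of k xs m] by (auto simp: closed_Compl disjnt_def)
    ultimately obtain f where f: "continuous_map euclidean (subtopology euclidean {0..1::real}) f"
        "f ` (- Oset k xs) \<subseteq> {0}" "f ` C k xs m \<subseteq> {1}"
      using Urysohn_completely_regular_compact_closed[of "0::real" 1] zero_le_one by metis
    then show ?thesis
      by (intro exI[of _ f]) (auto simp: continuous_map_in_subtopology image_subset_iff Pi_iff)
  qed
  then obtain \<psi> where \<psi>: "\<And>k xs m. continuous_on UNIV (\<psi> k xs m)"
    "\<And>k xs m x. 0 \<le> \<psi> k xs m x" "\<And>k xs m x. \<psi> k xs m x \<le> (1::real)"
    "\<And>k xs m x. x \<in> C k xs m \<Longrightarrow> \<psi> k xs m x = 1"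
    "\<And>k xs m x. x \<notin> Oset k xs \<Longrightarrow> \<psi> k xs m x = 0" by metis
  define \<phi> where "\<phi> i = (case from_nat i of (k, xs, m) \<Rightarrow> \<psi> k xs m)" for i
  have \<phi>_to_nat: "\<phi> (to_nat (k, xs, m)) = \<psi> k xs m" for k xs m by (simp add: \<phi>_def)
  have det: "M = N" if MN: "sets M = sets borel" "sets N = sets borel"
      "\<And>K. compact K \<Longrightarrow> emeasure M K < \<infinity>"
      "\<And>i. (\<integral>\<^sup>+ x. ennreal (\<phi> i x) \<partial>M) = (\<integral>\<^sup>+ x. ennreal (\<phi> i x) \<partial>N)" for M N
  proof -
    define E where "E = {Oset k xs | k xs. True}"
    \<comment> \<open>The functions need not increase with \<open>m\<close>, so the limit is
      squeezed between the measures of the compact sets and of the open set.\<close>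
    have lim: "(\<lambda>m. \<integral>\<^sup>+ x. ennreal (\<psi> k xs m x) \<partial>L) \<longlonglongrightarrow> emeasure L (Oset k xs)"
      if L: "sets L = sets borel" for L k xs
    proof (rule tendsto_sandwich)
      have *: "Oset k xs \<in> sets L" "C k xs m \<in> sets L" for m
        using op cC L by (auto intro: borel_compact)
      show "(\<lambda>m. emeasure L (C k xs m)) \<longlonglongrightarrow> emeasure L (Oset k xs)"
        using Lim_emeasure_incseq[of "C k xs" L] C_inc C_UN * by (auto simp: image_subset_iff)
      show "\<forall>\<^sub>F m in sequentially. emeasure L (C k xs m) \<le> (\<integral>\<^sup>+ x. ennreal (\<psi> k xs m x) \<partial>L)"
      proof (rule always_eventually, rule allI)
        fix m
        have "emeasure L (C k xs m) = (\<integral>\<^sup>+ x. indicator (C k xs m) x \<partial>L)" using * by simp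
        also have "\<dots> \<le> (\<integral>\<^sup>+ x. ennreal (\<psi> k xs m x) \<partial>L)"
          by (intro nn_integral_mono) (auto simp: indicator_def \<psi>)
        finally show "emeasure L (C k xs m) \<le> (\<integral>\<^sup>+ x. ennreal (\<psi> k xs m x) \<partial>L)" .
      qed
      show "\<forall>\<^sub>F m in sequentially. (\<integral>\<^sup>+ x. ennreal (\<psi> k xs m x) \<partial>L) \<le> emeasure L (Oset k xs)"
      proof (rule always_eventually, rule allI)
        fix m
        have "(\<integral>\<^sup>+ x. ennreal (\<psi> k xs m x) \<partial>L) \<le> (\<integral>\<^sup>+ x. indicator (Oset k xs) x \<partial>L)"
          by (intro nn_integral_mono) (auto simp: indicator_def \<psi>)
        also have "\<dots> = emeasure L (Oset k xs)" using * by simp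
        finally show "(\<integral>\<^sup>+ x. ennreal (\<psi> k xs m x) \<partial>L) \<le> emeasure L (Oset k xs)" .
      qed
    qed simp
    have U_O: "U k = Oset k []" for k by (simp add: Oset_def)
    have sE: "sets (borel :: 'g measure) = sigma_sets UNIV E"
    proof (rule sets_borel_eq_base[OF U(1)])
      show "\<exists>n. x \<in> U n \<and> U n \<subseteq> W" if "open W" "x \<in> W" for W x
        using U(3)[OF that] closure_subset by blast
    qed (use op U_O in \<open>auto simp: E_def\<close>)
    show "M = N"
    proof (rule measure_eqI_generator_eq_countable[where E = E and \<Omega> = UNIV and A = "range U"])
      have "Oset k xs \<inter> Oset l ys = Oset k (xs @ l # ys)" for k xs l ys
        by (auto simp: Oset_def)
      then show "Int_stable E" unfolding Int_stable_def E_def by blast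
      show "emeasure M X = emeasure N X" if X_E: "X \<in> E" for X
      proof -
        obtain k xs where X: "X = Oset k xs" using X_E by (auto simp: E_def)
        have "(\<integral>\<^sup>+ x. ennreal (\<psi> k xs m x) \<partial>M) = (\<integral>\<^sup>+ x. ennreal (\<psi> k xs m x) \<partial>N)" for m
          using MN(4)[of "to_nat (k, xs, m)"] by (simp add: \<phi>_to_nat)
        then show ?thesis
          using lim[OF MN(1), of k xs] lim[OF MN(2), of k xs] unfolding X
          by (simp add: LIMSEQ_unique)
      qed
      show "\<Union> (range U) = UNIV" using U(3)[of UNIV] by blast
      fix a assume "a \<in> range U"
      then obtain n where n: "a = U n" by blast
      have "emeasure M (U n) \<le> emeasure M (closure (U n))"
        by (intro emeasure_mono closure_subset) (simp add: MN(1))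
      then show "emeasure M a \<noteq> \<infinity>" using MN(3)[OF U(2), of n] by (auto simp: n top_unique)
    qed (use sE MN U_O in \<open>auto simp: E_def\<close>)
  qed
  show thesis
  proof (rule that[OF _ _ _ _ det])
    fix i
    show "continuous_on UNIV (\<phi> i)" "\<And>x. 0 \<le> \<phi> i x" "\<And>x. \<phi> i x \<le> 1"
      by (auto simp: \<phi>_def \<psi> split: prod.split)
    obtain k xs m where i: "from_nat i = (k :: nat, xs :: nat list, m :: nat)"
      by (metis prod_cases3)
    have "Oset k xs \<subseteq> closure (U k)" using closure_subset unfolding Oset_def by blast
    then show "\<exists>K. compact K \<and> (\<forall>x. x \<notin> K \<longrightarrow> \<phi> i x = 0)"
      using U(2) by (intro exI[of _ "closure (U k)"]) (auto simp: \<phi>_def i intro!: \<psi>(5))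
  qed
qed

text \<open>One point is picked from each basic set that meets \<open>C\<close>. The points must lie
  in \<open>C\<close> itself, since a compact \<open>C\<close> may contain no point of a given
  countable dense set of the whole space.\<close>

lemma countable_dense_subset:
  fixes C :: "'a::second_countable_topology set"
  obtains D where "countable D" "D \<subseteq> C" "C \<subseteq> closure D"
proof -
  obtain B :: "'a set set" where B: "countable B" "topological_basis B"
    using ex_countable_basis by blast
  define D where "D = (\<lambda>b. SOME x. x \<in> b \<inter> C) ` {b \<in> B. b \<inter> C \<noteq> {}}"
  have pick: "(SOME x. x \<in> b \<inter> C) \<in> b \<inter> C" if "b \<inter> C \<noteq> {}" for b
    using that someI_ex[of "\<lambda>x. x \<in> b \<inter> C"] by blast
  show thesis
  proof
    show "countable D" using B(1) unfolding D_def by (intro countable_image) (auto intro: countable_subset)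
    show "D \<subseteq> C" using pick unfolding D_def by blast
    show "C \<subseteq> closure D"
    proof
      fix x assume x: "x \<in> C"
      have "\<exists>y\<in>D. y \<in> W" if W: "open W" "x \<in> W" for W
      proof -
        obtain b where b: "b \<in> B" "x \<in> b" "b \<subseteq> W" using topological_basisE[OF B(2) W] by blast
        then have "b \<inter> C \<noteq> {}" using x by blast
        with b pick[OF this] show ?thesis unfolding D_def by blast
      qed
      then show "x \<in> closure D" unfolding closure_iff_nhds_not_empty by blast
    qed
  qed
qed

section \<open>Haar measure\<close>

lemma borel_measurable_group_uminus [measurable (raw)]:
  fixes f :: "'a \<Rightarrow> 'b::{second_countable_topology, topological_group_add}"
  assumes "f \<in> borel_measurable M"
  shows "(\<lambda>x. - f x) \<in> borel_measurable M"
  by (rule borel_measurable_continuous_on[OF _ assms]) (intro continuous_intros)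

lemma left_haar_measureD:
  assumes "left_haar_measure M"
  shows "sets M = sets borel" "\<And>K. compact K \<Longrightarrow> emeasure M K < \<infinity>"
    "\<And>U. open U \<Longrightarrow> U \<noteq> {} \<Longrightarrow> 0 < emeasure M U" "\<And>g. distr M borel (\<lambda>h. g + h) = M"
  using assms by (auto simp: left_haar_measure_def)

lemma nn_integral_left_translate:
  fixes M :: "'g::{topological_group_add, second_countable_topology} measure"
  assumes "left_haar_measure M" and f [measurable]: "f \<in> borel_measurable borel"
  shows "(\<integral>\<^sup>+ h. f (g + h) \<partial>M) = (\<integral>\<^sup>+ h. f h \<partial>M)"
proof -
  note [measurable_cong] = left_haar_measureD(1)[OF assms(1)]
  have "(\<integral>\<^sup>+ h. f (g + h) \<partial>M) = (\<integral>\<^sup>+ h. f h \<partial>distr M borel (\<lambda>h. g + h))"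
    by (subst nn_integral_distr) auto
  then show ?thesis using left_haar_measureD(4)[OF assms(1)] by simp
qed

lemma sigma_finite_measure_if_compact_finite:
  fixes M :: "'g::{t2_space, second_countable_topology} measure"
  assumes lc: "locally_compact_space (euclidean :: 'g topology)"
    and M: "sets M = sets borel" "\<And>K. compact K \<Longrightarrow> emeasure M K < \<infinity>"
  shows "sigma_finite_measure M"
proof
  obtain U :: "nat \<Rightarrow> 'g set" where U: "\<And>n. open (U n)" "\<And>n. compact (closure (U n))"
    "\<And>W x. open W \<Longrightarrow> x \<in> W \<Longrightarrow> \<exists>n. x \<in> U n \<and> closure (U n) \<subseteq> W"
    using locally_compact_base[OF lc] by blast
  have "(\<Union>n. closure (U n)) = UNIV" using U(3)[OF open_UNIV] closure_subset by fast
  moreover have "space M = UNIV" using sets_eq_imp_space_eq[OF M(1)] by simp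
  moreover have "emeasure M (closure (U n)) \<noteq> \<infinity>" for n using M(2)[OF U(2), of n] by simp
  ultimately show "\<exists>A. countable A \<and> A \<subseteq> sets M \<and> \<Union> A = space M \<and> (\<forall>a\<in>A. emeasure M a \<noteq> \<infinity>)"
    by (intro exI[of _ "range (\<lambda>n. closure (U n))"]) (auto simp: M(1))
qed

lemma left_haar_sigma_finite:
  fixes M :: "'g::{topological_group_add, t2_space, second_countable_topology} measure"
  assumes "locally_compact_space (euclidean :: 'g topology)" "left_haar_measure M"
  shows "sigma_finite_measure M"
  by (rule sigma_finite_measure_if_compact_finite[OF assms(1) left_haar_measureD(1)[OF assms(2)]])
    (rule left_haar_measureD(2)[OF assms(2)])

text \<open>The substitutions \<open>y \<mapsto> -x + y\<close> and then \<open>x \<mapsto> y + x\<close>, each for the measure of its own variable.\<close>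

lemma haar_pair_substitution:
  fixes M N :: "'g::{topological_group_add, t2_space, second_countable_topology} measure"
  assumes lc: "locally_compact_space (euclidean :: 'g topology)"
    and M: "left_haar_measure M" and N: "left_haar_measure N"
    and F [measurable]: "(\<lambda>(x, y). F x y) \<in> borel_measurable (borel \<Otimes>\<^sub>M borel)"
  shows "(\<integral>\<^sup>+ y. \<integral>\<^sup>+ x. F (- y) (x + y) \<partial>M \<partial>N) = (\<integral>\<^sup>+ y. \<integral>\<^sup>+ x. F x y \<partial>M \<partial>N)"
proof -
  note [measurable_cong] = left_haar_measureD(1)[OF M] left_haar_measureD(1)[OF N]
  interpret M: sigma_finite_measure M using left_haar_sigma_finite[OF lc M] .
  interpret N: sigma_finite_measure N using left_haar_sigma_finite[OF lc N] .
  interpret pair_sigma_finite M N ..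
  have "(\<integral>\<^sup>+ y. \<integral>\<^sup>+ x. F (- y) (x + y) \<partial>M \<partial>N) = (\<integral>\<^sup>+ x. \<integral>\<^sup>+ y. F (- y) (x + y) \<partial>N \<partial>M)"
    by (rule Fubini') measurable
  also have "\<dots> = (\<integral>\<^sup>+ x. \<integral>\<^sup>+ y. F (- (- x + y)) (x + (- x + y)) \<partial>N \<partial>M)"
    by (intro nn_integral_cong nn_integral_left_translate[OF N, symmetric]) measurable
  also have "\<dots> = (\<integral>\<^sup>+ x. \<integral>\<^sup>+ y. F (- y + x) y \<partial>N \<partial>M)"
    by (simp add: minus_add add.assoc[symmetric])
  also have "\<dots> = (\<integral>\<^sup>+ y. \<integral>\<^sup>+ x. F (- y + x) y \<partial>M \<partial>N)"
    by (rule Fubini'[symmetric]) measurable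
  also have "\<dots> = (\<integral>\<^sup>+ y. \<integral>\<^sup>+ x. F x y \<partial>M \<partial>N)"
    by (intro nn_integral_cong nn_integral_left_translate[OF M]) measurable
  finally show ?thesis .
qed

text \<open>Let \<open>D x\<close> be the \<open>M\<close>-measure of the right translate of
  \<open>C\<close> by \<open>x\<close>. Multiplying and dividing the integrand by
  \<open>D (- y)\<close> and expanding one factor as an integral gives a double integral whose
  variables the substitution separates. Hence every left Haar measure \<open>L\<close> integrates
  \<open>f\<close> to \<open>emeasure L C\<close> times a quantity depending only on
  \<open>M\<close> and \<open>f\<close>.\<close>

lemma left_haar_unique:
  fixes M N :: "'g::{topological_group_add, t2_space, second_countable_topology} measure"
  assumes lc: "locally_compact_space (euclidean :: 'g topology)"
    and M: "left_haar_measure M" and N: "left_haar_measure N"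
  obtains c :: ennreal where "0 < c" "c < \<infinity>"
    "\<And>f. f \<in> borel_measurable borel \<Longrightarrow> (\<integral>\<^sup>+ x. f x \<partial>N) = c * (\<integral>\<^sup>+ x. f x \<partial>M)"
proof -
  note [measurable_cong] = left_haar_measureD(1)[OF M]
  interpret M: sigma_finite_measure M using left_haar_sigma_finite[OF lc M] .
  obtain U :: "nat \<Rightarrow> 'g set" where U: "\<And>n. open (U n)" "\<And>n. compact (closure (U n))"
    "\<And>W x. open W \<Longrightarrow> x \<in> W \<Longrightarrow> \<exists>n. x \<in> U n \<and> closure (U n) \<subseteq> W"
    using locally_compact_base[OF lc] by blast
  obtain n where n: "0 \<in> U n" using U(3)[of UNIV 0] by auto
  define C where "C = closure (U n)"
  have cC: "compact C" using U(2) by (simp add: C_def)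
  have [measurable]: "C \<in> sets borel" using cC by (rule borel_compact)
  \<comment> \<open>A right translate of \<open>C\<close> is compact and contains a nonempty open
    set. Its measure is therefore finite and positive, so division by \<open>D\<close> is
    legitimate.\<close>
  have C_bounds: "0 < emeasure L ((\<lambda>z. z + x) ` C)" "emeasure L ((\<lambda>z. z + x) ` C) < \<infinity>"
    if L: "left_haar_measure L" for L :: "'g measure" and x
  proof -
    have comp: "compact ((\<lambda>z. z + x) ` C)"
      by (intro compact_continuous_image cC continuous_intros)
    then show "emeasure L ((\<lambda>z. z + x) ` C) < \<infinity>" by (rule left_haar_measureD(2)[OF L])
    have "(\<lambda>z. z + x) ` U n = (\<lambda>z. z + - x) -` U n"
      by (force simp: image_iff add.assoc)
    moreover have "open ((\<lambda>z. z + - x) -` U n)"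
      by (intro open_vimage U(1) continuous_intros)
    ultimately have "0 < emeasure L ((\<lambda>z. z + x) ` U n)"
      using n by (intro left_haar_measureD(3)[OF L]) auto
    also have "\<dots> \<le> emeasure L ((\<lambda>z. z + x) ` C)"
      using comp closure_subset[of "U n"]
      by (intro emeasure_mono) (auto simp: left_haar_measureD(1)[OF L] C_def borel_compact)
    finally show "0 < emeasure L ((\<lambda>z. z + x) ` C)" .
  qed
  \<comment> \<open>The integral form makes measurability in \<open>x\<close> a consequence of
    Fubini's theorem.\<close>
  define D where "D x = (\<integral>\<^sup>+ z. indicator C (z + - x) \<partial>M)" for x
  have D_meas [measurable]: "D \<in> borel_measurable borel" unfolding D_def by measurable
  have D: "0 < D x" "D x < \<infinity>" for x
  proof -
    have "(\<lambda>z. z + x) ` C = {z. z + - x \<in> C}" by (force simp: image_iff add.assoc)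
    moreover have "D x = emeasure M {z \<in> space M. z + - x \<in> C}"
    proof -
      have "{z \<in> space M. z + - x \<in> C} \<in> sets M" by measurable
      then have "emeasure M {z \<in> space M. z + - x \<in> C} =
          (\<integral>\<^sup>+ z. indicator {z \<in> space M. z + - x \<in> C} z \<partial>M)" by simp
      also have "\<dots> = D x" unfolding D_def by (intro nn_integral_cong) (auto simp: indicator_def)
      finally show ?thesis ..
    qed
    moreover have "space M = UNIV" using sets_eq_imp_space_eq[OF left_haar_measureD(1)[OF M]] by simp
    ultimately show "0 < D x" "D x < \<infinity>" using C_bounds[OF M, of x] by auto
  qed
  have C0: "0 < emeasure L C" "emeasure L C < \<infinity>" if "left_haar_measure L" for L :: "'g measure"
    using C_bounds[OF that, of 0] by simp_all
  define I where "I f = (\<integral>\<^sup>+ x. f (- x) / D x \<partial>M)" for f :: "'g \<Rightarrow> ennreal"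
  have key: "(\<integral>\<^sup>+ x. f x \<partial>L) = emeasure L C * I f"
    if L: "left_haar_measure L" and f [measurable]: "f \<in> borel_measurable borel" for L f
  proof -
    note [measurable_cong] = left_haar_measureD(1)[OF L]
    have "(\<integral>\<^sup>+ y. f y \<partial>L) = (\<integral>\<^sup>+ y. f y / D (- y) * D (- y) \<partial>L)"
      using D by (intro nn_integral_cong) (simp add: ennreal_divide_times ennreal_mult_divide_eq less_imp_neq[symmetric])
    also have "\<dots> = (\<integral>\<^sup>+ y. \<integral>\<^sup>+ x. f (- (- y)) / D (- y) * indicator C (x + y) \<partial>M \<partial>L)"
      by (simp add: D_def nn_integral_cmult)
    also have "\<dots> = (\<integral>\<^sup>+ y. \<integral>\<^sup>+ x. f (- x) / D x * indicator C y \<partial>M \<partial>L)"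
      by (rule haar_pair_substitution[OF lc M L]) measurable
    also have "\<dots> = (\<integral>\<^sup>+ y. I f * indicator C y \<partial>L)"
      unfolding I_def by (simp add: nn_integral_multc)
    also have "\<dots> = emeasure L C * I f"
      by (simp add: nn_integral_cmult mult.commute)
    finally show ?thesis .
  qed
  show thesis
  proof
    show "0 < emeasure N C / emeasure M C" "emeasure N C / emeasure M C < \<infinity>"
      using C0[OF M] C0[OF N]
      by (auto simp: ennreal_zero_less_divide ennreal_divide_eq_top_iff less_top[symmetric])
    fix f :: "'g \<Rightarrow> ennreal" assume f: "f \<in> borel_measurable borel"
    show "(\<integral>\<^sup>+ x. f x \<partial>N) = emeasure N C / emeasure M C * (\<integral>\<^sup>+ x. f x \<partial>M)"
      unfolding key[OF N f] key[OF M f] using C0[OF M]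
      by (simp only: mult.assoc[symmetric] ennreal_divide_times)
        (simp add: ennreal_mult_divide_eq)
  qed
qed

text \<open>The constant is the value of the modular function at \<open>a\<close>.\<close>

lemma nn_integral_right_translate:
  fixes M :: "'g::{topological_group_add, t2_space, second_countable_topology} measure"
  assumes lc: "locally_compact_space (euclidean :: 'g topology)" and M: "left_haar_measure M"
  obtains c :: ennreal where "0 < c" "c < \<infinity>"
    "\<And>f. f \<in> borel_measurable borel \<Longrightarrow> (\<integral>\<^sup>+ x. f (x + a) \<partial>M) = c * (\<integral>\<^sup>+ x. f x \<partial>M)"
proof -
  note [measurable_cong] = left_haar_measureD(1)[OF M]
  \<comment> \<open>The image under right translation is again a left Haar measure, because left and
    right translations commute. Uniqueness then yields the constant.\<close>
  define N where "N = distr M borel (\<lambda>h. h + a)"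
  have space_M: "space M = UNIV" using sets_eq_imp_space_eq[OF left_haar_measureD(1)[OF M]] by simp
  have em: "emeasure N A = emeasure M ((\<lambda>h. h + - a) ` A)" if "A \<in> sets borel" for A
  proof -
    have "(\<lambda>h. h + a) -` A \<inter> space M = (\<lambda>h. h + - a) ` A"
      by (force simp: image_iff space_M add.assoc)
    then show ?thesis unfolding N_def using that by (simp add: emeasure_distr)
  qed
  have "left_haar_measure N"
    unfolding left_haar_measure_def
  proof (intro conjI allI impI)
    show "sets N = sets borel" by (simp add: N_def)
    fix K :: "'g set" assume K: "compact K"
    then have "compact ((\<lambda>h. h + - a) ` K)" by (intro compact_continuous_image continuous_intros)
    then show "emeasure N K < \<infinity>"
      using em[OF borel_compact[OF K]] left_haar_measureD(2)[OF M] by simp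
  next
    fix V :: "'g set" assume V: "open V \<and> V \<noteq> {}"
    have "(\<lambda>h. h + - a) ` V = (\<lambda>h. h + a) -` V" by (force simp: image_iff add.assoc)
    moreover have "open ((\<lambda>h. h + a) -` V)" using V by (intro open_vimage continuous_intros) auto
    ultimately have "0 < emeasure M ((\<lambda>h. h + - a) ` V)"
      using V by (intro left_haar_measureD(3)[OF M]) auto
    then show "0 < emeasure N V" using em[of V] V by simp
  next
    fix g
    have "distr N borel (\<lambda>h. g + h) = distr (distr M borel (\<lambda>h. g + h)) borel (\<lambda>h. h + a)"
      unfolding N_def by (simp add: distr_distr comp_def add.assoc)
    then show "distr N borel (\<lambda>h. g + h) = N"
      using left_haar_measureD(4)[OF M] by (simp add: N_def)
  qed
  from left_haar_unique[OF lc M this] obtain c where c: "0 < c" "c < \<infinity>"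
    "\<And>f. f \<in> borel_measurable borel \<Longrightarrow> (\<integral>\<^sup>+ x. f x \<partial>N) = c * (\<integral>\<^sup>+ x. f x \<partial>M)" by blast
  show thesis
  proof (rule that[OF c(1,2)])
    fix f :: "'g \<Rightarrow> ennreal" assume [measurable]: "f \<in> borel_measurable borel"
    show "(\<integral>\<^sup>+ x. f (x + a) \<partial>M) = c * (\<integral>\<^sup>+ x. f x \<partial>M)"
      by (subst c(3)[symmetric]) (auto simp: N_def nn_integral_distr)
  qed
qed

section \<open>Borel actions\<close>

locale borel_action =
  fixes lam :: "'g::{topological_group_add, t2_space, second_countable_topology} measure"
    and S :: "'s measure"
    and act :: "'g \<Rightarrow> 's \<Rightarrow> 's"
  assumes lc: "locally_compact_space (euclidean :: 'g topology)"
    and haar: "left_haar_measure lam"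
    and iso: "borel_space_iso S"
    and action: "measurable_action act S"
begin

lemma sets_lam [simp, measurable_cong]: "sets lam = sets borel"
  by (rule left_haar_measureD(1)[OF haar])

lemma space_lam [simp]: "space lam = UNIV"
  using sets_eq_imp_space_eq[OF sets_lam] by simp

lemma act_closed [simp]: "s \<in> space S \<Longrightarrow> act g s \<in> space S"
  and act_zero [simp]: "s \<in> space S \<Longrightarrow> act 0 s = s"
  and act_add: "s \<in> space S \<Longrightarrow> act (g + h) s = act g (act h s)"
  using action by (auto simp: measurable_action_def)

lemma act_uminus [simp]: "s \<in> space S \<Longrightarrow> act (- g) (act g s) = s"
  by (simp add: act_add[symmetric])

lemma measurable_act [measurable (raw)]:
  assumes "f \<in> M \<rightarrow>\<^sub>M borel" "t \<in> M \<rightarrow>\<^sub>M S"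
  shows "(\<lambda>x. act (f x) (t x)) \<in> M \<rightarrow>\<^sub>M S"
proof -
  have "(\<lambda>(g, s). act g s) \<in> borel \<Otimes>\<^sub>M S \<rightarrow>\<^sub>M S"
    using action by (simp add: measurable_action_def)
  from measurable_comp[OF measurable_Pair[OF assms] this] show ?thesis by (simp add: comp_def)
qed

text \<open>Boundedness of the code is for domination of integrals, injectivity for the separation
  of points.\<close>

lemma space_code:
  obtains j :: "'s \<Rightarrow> real" where "j \<in> S \<rightarrow>\<^sub>M borel" "\<And>s. s \<in> space S \<Longrightarrow> 0 \<le> j s \<and> j s \<le> 1"
    "inj_on j (space S)"
proof -
  obtain B :: "real set" and f h where B: "B \<in> sets borel" "B \<subseteq> {0..1}"
    "f \<in> S \<rightarrow>\<^sub>M restrict_space borel B" "\<forall>x\<in>space S. h (f x) = x"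
    using iso unfolding borel_space_iso_def by blast
  have "f \<in> S \<rightarrow>\<^sub>M borel" using B(3) by (simp add: measurable_restrict_space2_iff)
  moreover have "0 \<le> f s \<and> f s \<le> 1" if "s \<in> space S" for s
    using measurable_space[OF B(3) that] B(2) by (auto simp: space_restrict_space)
  moreover have "inj_on f (space S)" using B(4) by (metis inj_onI)
  ultimately show thesis using that by blast
qed

section \<open>Right Haar measure and functions continuous along orbits\<close>

definition rho :: "'g measure" where "rho = distr lam borel uminus"

lemma sets_rho [simp, measurable_cong]: "sets rho = sets borel"
  by (simp add: rho_def)

lemma space_rho [simp]: "space rho = UNIV"
  by (simp add: rho_def)

text \<open>Inversion turns right translation into left translation. Right invariance is the form
  that suits \<open>act g (act a s) = act (g + a) s\<close>.\<close>

lemma nn_integral_rho_translate: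
  assumes [measurable]: "f \<in> borel_measurable borel"
  shows "(\<integral>\<^sup>+ g. f (g + a) \<partial>rho) = (\<integral>\<^sup>+ g. f g \<partial>rho)"
proof -
  have "(\<integral>\<^sup>+ g. f (g + a) \<partial>rho) = (\<integral>\<^sup>+ h. f (- (- a + h)) \<partial>lam)"
    unfolding rho_def by (subst nn_integral_distr) (auto simp: minus_add)
  also have "\<dots> = (\<integral>\<^sup>+ h. f (- h) \<partial>lam)"
    by (rule nn_integral_left_translate[OF haar]) measurable
  also have "\<dots> = (\<integral>\<^sup>+ g. f g \<partial>rho)"
    unfolding rho_def by (subst nn_integral_distr) auto
  finally show ?thesis .
qed

lemma emeasure_rho_compact:
  assumes "compact K" shows "emeasure rho K < \<infinity>"
proof -
  have "emeasure rho K = emeasure lam (uminus -` K \<inter> space lam)"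
    unfolding rho_def using borel_compact[OF assms] by (subst emeasure_distr) auto
  also have "uminus -` K \<inter> space lam = uminus ` K" by (force simp: image_iff)
  also have "emeasure lam \<dots> < \<infinity>"
    by (intro left_haar_measureD(2)[OF haar] compact_continuous_image assms continuous_intros)
  finally show ?thesis .
qed

text \<open>The group has positive measure. The separation argument below needs just one group
  element from a set of full measure.\<close>

lemma AE_rho_ex:
  assumes "AE g in rho. P g" shows "\<exists>g. P g"
proof (rule ccontr)
  assume "\<nexists>g. P g"
  with assms have "AE g in rho. False" by simp
  then have "emeasure rho UNIV = 0" by (simp add: AE_iff_measurable[OF _ refl])
  moreover have "emeasure rho UNIV = emeasure lam UNIV"
    unfolding rho_def by (subst emeasure_distr) auto
  ultimately show False using left_haar_measureD(3)[OF haar, of UNIV] by simp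
qed

text \<open>Convolving a code of the state space against continuous functions of compact support
  makes it continuous along orbits. Right invariance moves the translation onto the continuous factor.\<close>

lemma orbit_continuous_functions:
  obtains F :: "nat \<Rightarrow> 's \<Rightarrow> real" where
    "\<And>i. F i \<in> S \<rightarrow>\<^sub>M borel"
    "\<And>i s. s \<in> space S \<Longrightarrow> continuous_on UNIV (\<lambda>a. F i (act a s))"
    "\<And>s t. s \<in> space S \<Longrightarrow> t \<in> space S \<Longrightarrow> (\<And>i. F i s = F i t) \<Longrightarrow> s = t"
proof -
  obtain j :: "'s \<Rightarrow> real" where j [measurable]: "j \<in> S \<rightarrow>\<^sub>M borel"
    and j01: "\<And>s. s \<in> space S \<Longrightarrow> 0 \<le> j s \<and> j s \<le> 1" and j_inj: "inj_on j (space S)"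
    using space_code by blast
  obtain \<phi> :: "nat \<Rightarrow> 'g \<Rightarrow> real" where \<phi>: "\<And>i. continuous_on UNIV (\<phi> i)" "\<And>i x. 0 \<le> \<phi> i x"
    "\<And>i x. \<phi> i x \<le> 1" "\<And>i. \<exists>K. compact K \<and> (\<forall>x. x \<notin> K \<longrightarrow> \<phi> i x = 0)"
    and det: "\<And>M N. sets M = sets borel \<Longrightarrow> sets N = sets borel \<Longrightarrow>
      (\<And>K. compact K \<Longrightarrow> emeasure M K < \<infinity>) \<Longrightarrow>
      (\<And>i. (\<integral>\<^sup>+ x. ennreal (\<phi> i x) \<partial>M) = (\<integral>\<^sup>+ x. ennreal (\<phi> i x) \<partial>N)) \<Longrightarrow> M = N"
    using countable_determining_functions[OF lc] by metis
  have \<phi>_meas [measurable]: "\<phi> i \<in> borel_measurable borel" for i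
    by (rule borel_measurable_continuous_onI[OF \<phi>(1)])
  define E where "E i s = (\<integral>\<^sup>+ g. ennreal (j (act g s)) * ennreal (\<phi> i g) \<partial>rho)" for i s
  interpret rho: sigma_finite_measure rho
    by (rule sigma_finite_measure_if_compact_finite[OF lc sets_rho emeasure_rho_compact])
  have E_meas [measurable]: "E i \<in> borel_measurable S" for i
    unfolding E_def by measurable
  have E_fin: "E i s < \<infinity>" if s: "s \<in> space S" for i s
  proof -
    obtain K where K: "compact K" "\<And>x. x \<notin> K \<Longrightarrow> \<phi> i x = 0" using \<phi>(4) by blast
    have "E i s \<le> (\<integral>\<^sup>+ g. indicator K g \<partial>rho)"
      unfolding E_def
    proof (rule nn_integral_mono)
      fix g
      have "ennreal (j (act g s)) * ennreal (\<phi> i g) \<le> 1 * 1"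
        using j01[OF act_closed[OF s]] \<phi>(3) by (intro mult_mono) (auto simp: ennreal_le_1)
      then show "ennreal (j (act g s)) * ennreal (\<phi> i g) \<le> indicator K g"
        using K(2) by (cases "g \<in> K") auto
    qed
    also have "\<dots> < \<infinity>" using emeasure_rho_compact[OF K(1)] borel_compact[OF K(1)] by simp
    finally show ?thesis .
  qed
  have E_shift: "E i (act a s) = (\<integral>\<^sup>+ g. ennreal (j (act g s)) * ennreal (\<phi> i (g + - a)) \<partial>rho)"
    if [measurable]: "s \<in> space S" for i a s
  proof -
    have "E i (act a s) = (\<integral>\<^sup>+ g. ennreal (j (act (g + a) s)) * ennreal (\<phi> i (g + a + - a)) \<partial>rho)"
      unfolding E_def using that by (simp add: act_add add.assoc)
    also have "\<dots> = (\<integral>\<^sup>+ g. ennreal (j (act g s)) * ennreal (\<phi> i (g + - a)) \<partial>rho)"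
      by (rule nn_integral_rho_translate) measurable
    finally show ?thesis .
  qed
  have E_cont: "continuous_on UNIV (\<lambda>a. E i (act a s))" if s [measurable]: "s \<in> space S" for i s
  proof (rule continuous_on_sequentiallyI)
    fix u :: "nat \<Rightarrow> 'g" and a assume u: "u \<longlonglongrightarrow> a"
    obtain U :: "nat \<Rightarrow> 'g set" where U: "\<And>n. open (U n)" "\<And>n. compact (closure (U n))"
      "\<And>W x. open W \<Longrightarrow> x \<in> W \<Longrightarrow> \<exists>n. x \<in> U n \<and> closure (U n) \<subseteq> W"
      using locally_compact_base[OF lc] by blast
    obtain n where n: "a \<in> U n" using U(3)[of UNIV a] by auto
    obtain N where N: "\<And>m. m \<ge> N \<Longrightarrow> u m \<in> U n"
      using topological_tendstoD[OF u U(1) n] unfolding eventually_sequentially by blast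
    obtain K where K: "compact K" "\<And>x. x \<notin> K \<Longrightarrow> \<phi> i x = 0" using \<phi>(4) by blast
    \<comment> \<open>The compact set \<open>L\<close> contains all translates of \<open>K\<close>
      by points of \<open>closure (U n)\<close>, so its indicator dominates all integrands once the
      first \<open>N\<close> terms of \<open>u\<close> are dropped.\<close>
    define L where "L = (\<lambda>(x, y). x + y) ` (K \<times> closure (U n))"
    have cL: "compact L" unfolding L_def split_def
      by (intro compact_continuous_image compact_Times K(1) U(2) continuous_intros)
    have "(\<lambda>m. E i (act (u (m + N)) s)) \<longlonglongrightarrow> E i (act a s)"
      unfolding E_shift[OF s]
    proof (rule nn_integral_dominated_convergence[where w = "indicator L"])
      show "(\<integral>\<^sup>+ g. indicator L g \<partial>rho) < \<infinity>"
        using emeasure_rho_compact[OF cL] borel_compact[OF cL] by simp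
      show "AE g in rho. ennreal (j (act g s)) * ennreal (\<phi> i (g + - u (m + N))) \<le> indicator L g" for m
      proof (rule AE_I2)
        fix g
        have "ennreal (j (act g s)) * ennreal (\<phi> i (g + - u (m + N))) \<le> 1 * 1"
          using j01[OF act_closed[OF s]] \<phi>(3) by (intro mult_mono) (auto simp: ennreal_le_1)
        moreover have "g \<in> L" if "g + - u (m + N) \<in> K"
        proof -
          have "u (m + N) \<in> closure (U n)" using N[of "m + N"] closure_subset by auto
          then have "(g + - u (m + N), u (m + N)) \<in> K \<times> closure (U n)" using that by blast
          then show ?thesis unfolding L_def by (rule rev_image_eqI) (simp add: add.assoc)
        qed
        ultimately show "ennreal (j (act g s)) * ennreal (\<phi> i (g + - u (m + N))) \<le> indicator L g"
          using K(2)[of "g + - u (m + N)"] by (cases "g + - u (m + N) \<in> K") auto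
      qed
      show "AE g in rho. (\<lambda>m. ennreal (j (act g s)) * ennreal (\<phi> i (g + - u (m + N))))
          \<longlonglongrightarrow> ennreal (j (act g s)) * ennreal (\<phi> i (g + - a))"
      proof (rule AE_I2)
        fix g
        have "(\<lambda>m. g + - u (m + N)) \<longlonglongrightarrow> g + - a"
          by (intro tendsto_intros LIMSEQ_ignore_initial_segment u)
        then have "(\<lambda>m. \<phi> i (g + - u (m + N))) \<longlonglongrightarrow> \<phi> i (g + - a)"
          using continuous_on_tendsto_compose[OF \<phi>(1)] by auto
        then have "(\<lambda>m. ennreal (j (act g s) * \<phi> i (g + - u (m + N))))
            \<longlonglongrightarrow> ennreal (j (act g s) * \<phi> i (g + - a))"
          by (intro tendsto_intros)
        then show "(\<lambda>m. ennreal (j (act g s)) * ennreal (\<phi> i (g + - u (m + N))))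
            \<longlonglongrightarrow> ennreal (j (act g s)) * ennreal (\<phi> i (g + - a))"
          using j01[OF act_closed[OF s]] \<phi>(2) by (simp add: ennreal_mult)
      qed
    qed (use borel_compact[OF cL] in measurable)
    then show "(\<lambda>m. E i (act (u m) s)) \<longlonglongrightarrow> E i (act a s)" by (rule LIMSEQ_offset)
  qed
  have E_sep: "s = t" if s [measurable]: "s \<in> space S" and t [measurable]: "t \<in> space S"
      and eq: "\<And>i. E i s = E i t" for s t
  proof -
    \<comment> \<open>\<open>E i s\<close> is the integral of \<open>\<phi> i\<close> against
      \<open>P s\<close>, so equal values for all \<open>i\<close> give \<open>P s = P t\<close> and
      hence equal densities almost everywhere. One common \<open>g\<close> suffices, as
      \<open>j\<close> is injective and \<open>act g\<close> invertible.\<close>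
    define P where "P r = density rho (\<lambda>g. ennreal (j (act g r)))" for r
    have P_fin: "emeasure (P s) K < \<infinity>" if K: "compact K" for K
    proof -
      have "emeasure (P s) K = (\<integral>\<^sup>+ g. ennreal (j (act g s)) * indicator K g \<partial>rho)"
        unfolding P_def using borel_compact[OF K] by (intro emeasure_density) auto
      also have "\<dots> \<le> (\<integral>\<^sup>+ g. indicator K g \<partial>rho)"
        using j01[OF act_closed[OF s]] 
        by (intro nn_integral_mono) (auto simp: indicator_def ennreal_le_1)
      also have "\<dots> < \<infinity>" using emeasure_rho_compact[OF K] borel_compact[OF K] by simp
      finally show ?thesis .
    qed
    have "P s = P t"
    proof (rule det[OF _ _ P_fin])
      fix i
      have "(\<integral>\<^sup>+ x. ennreal (\<phi> i x) \<partial>P r) = E i r" if [measurable]: "r \<in> space S" for r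
        unfolding P_def E_def by (rule nn_integral_density) measurable
      then show "(\<integral>\<^sup>+ x. ennreal (\<phi> i x) \<partial>P s) = (\<integral>\<^sup>+ x. ennreal (\<phi> i x) \<partial>P t)"
        using eq s t by simp
    qed (auto simp: P_def)
    then have "AE g in rho. ennreal (j (act g s)) = ennreal (j (act g t))"
      unfolding P_def by (subst (asm) rho.density_unique_iff) auto
    then obtain g where "ennreal (j (act g s)) = ennreal (j (act g t))" using AE_rho_ex by blast
    then have "j (act g s) = j (act g t)" using j01 s t by auto
    then have "act g s = act g t" using j_inj s t by (auto dest: inj_onD)
    then show "s = t" using act_uminus[OF s] act_uminus[OF t] by metis
  qed
  \<comment> \<open>\<open>E i\<close> is finite on \<open>space S\<close>, so passing to real
    values loses no information.\<close>
  define F where "F i s = enn2real (E i s)" for i s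
  show thesis
  proof (rule that[of F])
    show "F i \<in> S \<rightarrow>\<^sub>M borel" for i unfolding F_def by measurable
    show "continuous_on UNIV (\<lambda>a. F i (act a s))" if s: "s \<in> space S" for i s
      unfolding F_def continuous_on_def
    proof
      fix a
      show "((\<lambda>a. enn2real (E i (act a s))) \<longlongrightarrow> enn2real (E i (act a s))) (at a within UNIV)"
        using E_cont[OF s, of i] E_fin[OF act_closed[OF s], of i a]
        by (intro tendsto_enn2real) (auto simp: continuous_on_def less_top[symmetric])
    qed
    show "s = t" if "s \<in> space S" "t \<in> space S" "\<And>i. F i s = F i t" for s t
    proof (rule E_sep[OF that(1,2)])
      fix i show "E i s = E i t"
        using that(3)[of i] E_fin[OF that(1), of i] E_fin[OF that(2), of i]
        unfolding F_def by (metis ennreal_enn2real infinity_ennreal_def)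
    qed
  qed
qed

section \<open>Measurable choice of transporting group elements\<close>

text \<open>The selection lemma is applied to the sets of all \<open>g\<close> carrying
  \<open>s\<close> to \<open>t\<close>. What must be shown measurable is whether such a
  \<open>g\<close> exists in a given compact set.\<close>

lemma measurable_transporter:
  obtains \<gamma> where "(\<lambda>(s, t). \<gamma> s t) \<in> borel_measurable (S \<Otimes>\<^sub>M S)"
    "\<And>s g. s \<in> space S \<Longrightarrow> act (\<gamma> s (act g s)) s = act g s"
proof -
  obtain F :: "nat \<Rightarrow> 's \<Rightarrow> real" where F [measurable]: "\<And>i. F i \<in> S \<rightarrow>\<^sub>M borel"
    and F_cont: "\<And>i s. s \<in> space S \<Longrightarrow> continuous_on UNIV (\<lambda>a. F i (act a s))"
    and F_sep: "\<And>s t. s \<in> space S \<Longrightarrow> t \<in> space S \<Longrightarrow> (\<And>i. F i s = F i t) \<Longrightarrow> s = t"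
    using orbit_continuous_functions by blast
  define \<Phi> where "\<Phi> = (\<lambda>(s, t). {g. act g s = t})"
  have dist_cont: "continuous_on UNIV (\<lambda>a. \<bar>F i (act a s) - F i t\<bar>)" if "s \<in> space S" for i s t
    by (intro continuous_intros F_cont that)
  have closed: "closed (\<Phi> x)" if "x \<in> space (S \<Otimes>\<^sub>M S)" for x
  proof -
    obtain s t where x: "x = (s, t)" "s \<in> space S" "t \<in> space S"
      using \<open>x \<in> space (S \<Otimes>\<^sub>M S)\<close> by (auto simp: space_pair_measure)
    have "\<Phi> x = {g. \<forall>i. F i (act g s) = F i t}"
      using F_sep[OF act_closed[OF x(2)] x(3)] by (auto simp: \<Phi>_def x(1))
    also have "closed \<dots>"
      by (intro closed_Collect_all closed_Collect_eq F_cont x(2) continuous_intros)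
    finally show ?thesis .
  qed
  have meas: "{x \<in> space (S \<Otimes>\<^sub>M S). \<Phi> x \<inter> C \<noteq> {}} \<in> sets (S \<Otimes>\<^sub>M S)" if C: "compact C" for C
  proof -
    obtain D where D: "countable D" "D \<subseteq> C" "C \<subseteq> closure D" using countable_dense_subset by blast
    \<comment> \<open>\<open>N\<close> bounds the number of functions compared and also sets the
      tolerance. With \<open>g\<close> ranging over a countable set, the right side is a countable
      combination of measurable conditions.\<close>
    have iff: "(\<exists>g\<in>C. act g s = t) \<longleftrightarrow>
        (\<forall>N::nat. \<exists>g\<in>D. \<forall>i<N. \<bar>F i (act g s) - F i t\<bar> < 1 / real (Suc N))"
      if st: "s \<in> space S" "t \<in> space S" for s t
    proof (intro iffI allI)
      fix N assume "\<exists>g\<in>C. act g s = t"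
      then obtain g where g: "g \<in> C" "act g s = t" by blast
      define W where "W = (\<Inter>i\<in>{..<N}. {a. \<bar>F i (act a s) - F i t\<bar> < 1 / real (Suc N)})"
      have "open W" unfolding W_def
        by (intro open_INT ballI open_Collect_less dist_cont st continuous_intros) auto
      moreover have "g \<in> W" using g by (auto simp: W_def)
      ultimately obtain h where "h \<in> D" "h \<in> W"
        using g(1) D(3) open_Int_closure_eq_empty[of W D] by blast
      then show "\<exists>g\<in>D. \<forall>i<N. \<bar>F i (act g s) - F i t\<bar> < 1 / real (Suc N)"
        by (auto simp: W_def)
    next
      assume *: "\<forall>N::nat. \<exists>g\<in>D. \<forall>i<N. \<bar>F i (act g s) - F i t\<bar> < 1 / real (Suc N)"
      \<comment> \<open>Weak inequalities, and \<open>C\<close> in place of \<open>D\<close>, make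
        these sets compact and decreasing, so a point common to all of them exists.\<close>
      define Z where "Z N = C \<inter> (\<Inter>i\<in>{..<N}. {a. \<bar>F i (act a s) - F i t\<bar> \<le> 1 / real (Suc N)})"
        for N
      have "(\<Inter>N. Z N) \<noteq> {}"
      proof (rule compact_decseq_Inter_nonempty)
        show "compact (Z N)" for N
          unfolding Z_def
          by (intro compact_Int_closed C closed_INT ballI closed_Collect_le dist_cont st continuous_intros)
        show "Z N \<noteq> {}" for N
        proof -
          obtain g where "g \<in> D" "\<forall>i<N. \<bar>F i (act g s) - F i t\<bar> < 1 / real (Suc N)"
            using * by blast
          then have "g \<in> Z N" using D(2) by (force simp: Z_def intro: less_imp_le)
          then show ?thesis by blast
        qed
        show "decseq Z"
        proof (rule decseq_SucI)
          fix N
          have "1 / real (Suc (Suc N)) \<le> 1 / real (Suc N)" by (simp add: field_simps)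
          then have "r \<le> 1 / real (Suc N)" if "r \<le> 1 / real (Suc (Suc N))" for r
            using that by (rule order_trans[rotated])
          then show "Z (Suc N) \<subseteq> Z N"
            by (auto simp: Z_def simp del: of_nat_Suc)
        qed
      qed
      then obtain g where g: "\<And>N. g \<in> Z N" by blast
      have "F i (act g s) = F i t" for i
      proof (rule ccontr)
        assume "F i (act g s) \<noteq> F i t"
        then obtain n where n: "1 / real (Suc n) < \<bar>F i (act g s) - F i t\<bar>"
          using nat_approx_posE[of "\<bar>F i (act g s) - F i t\<bar>"] by auto
        \<comment> \<open>\<open>Suc i\<close> brings the function with index \<open>i\<close> under
          control, and \<open>n\<close> makes the tolerance small enough.\<close>
        define N where "N = max (Suc i) n"
        have "\<bar>F i (act g s) - F i t\<bar> \<le> 1 / real (Suc N)"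
          using g[of N] by (auto simp: Z_def N_def)
        also have "\<dots> \<le> 1 / real (Suc n)" by (simp add: N_def field_simps)
        finally show False using n by simp
      qed
      then have "act g s = t" using F_sep[OF act_closed] st by blast
      then show "\<exists>g\<in>C. act g s = t" using g[of 0] by (auto simp: Z_def)
    qed
    have "{x \<in> space (S \<Otimes>\<^sub>M S). \<Phi> x \<inter> C \<noteq> {}} = {x \<in> space (S \<Otimes>\<^sub>M S).
        \<forall>N::nat. \<exists>g\<in>D. \<forall>i<N. \<bar>F i (act g (fst x)) - F i (snd x)\<bar> < 1 / real (Suc N)}"
    proof (intro Collect_cong conj_cong refl)
      fix x assume "x \<in> space (S \<Otimes>\<^sub>M S)"
      then have st: "fst x \<in> space S" "snd x \<in> space S" by (auto simp: space_pair_measure)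
      have "\<Phi> x \<inter> C \<noteq> {} \<longleftrightarrow> (\<exists>g\<in>C. act g (fst x) = snd x)"
        by (auto simp: \<Phi>_def split_def)
      then show "\<Phi> x \<inter> C \<noteq> {} \<longleftrightarrow>
          (\<forall>N::nat. \<exists>g\<in>D. \<forall>i<N. \<bar>F i (act g (fst x)) - F i (snd x)\<bar> < 1 / real (Suc N))"
        using iff[OF st] by simp
    qed
    also have "\<dots> \<in> sets (S \<Otimes>\<^sub>M S)"
      using D(1) by (intro sets.sets_Collect_countable_All sets.sets_Collect_countable_Ex'
          sets.sets_Collect_finite_All') measurable
    finally show ?thesis .
  qed
  obtain \<gamma> where \<gamma>: "\<gamma> \<in> S \<Otimes>\<^sub>M S \<rightarrow>\<^sub>M borel"
    "\<And>x. x \<in> space (S \<Otimes>\<^sub>M S) \<Longrightarrow> \<Phi> x \<noteq> {} \<Longrightarrow> \<gamma> x \<in> \<Phi> x"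
    using measurable_selector[OF lc closed meas] by blast
  show thesis
  proof (rule that[of "\<lambda>s t. \<gamma> (s, t)"])
    show "(\<lambda>(s, t). \<gamma> (s, t)) \<in> borel_measurable (S \<Otimes>\<^sub>M S)" using \<gamma>(1) by simp
    fix s g assume s: "s \<in> space S"
    then have "g \<in> \<Phi> (s, act g s)" by (simp add: \<Phi>_def)
    then show "act (\<gamma> (s, act g s)) s = act g s"
      using \<gamma>(2)[of "(s, act g s)"] s by (auto simp: \<Phi>_def space_pair_measure)
  qed
qed

end

section \<open>The averaged kernel\<close>

locale transported_action = borel_action lam S act
  for lam :: "'g::{topological_group_add, t2_space, second_countable_topology} measure"
    and S :: "'s measure" and act :: "'g \<Rightarrow> 's \<Rightarrow> 's" +
  fixes B :: "nat \<Rightarrow> 's set" and \<gamma> :: "'s \<Rightarrow> 's \<Rightarrow> 'g"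
  assumes B_sets [measurable]: "B n \<in> sets S"
    and B_cover: "(\<Union>n. B n) = space S"
    and B_finite: "s \<in> space S \<Longrightarrow> emeasure (orbit_measure lam act S s) (B n) < \<infinity>"
    and \<gamma>_measurable: "(\<lambda>(s, t). \<gamma> s t) \<in> borel_measurable (S \<Otimes>\<^sub>M S)"
    and \<gamma>_transports: "s \<in> space S \<Longrightarrow> act (\<gamma> s (act g s)) s = act g s"
begin

sublocale lam: sigma_finite_measure lam
  using left_haar_sigma_finite[OF lc haar] .

lemma measurable_\<gamma> [measurable (raw)]:
  assumes "f \<in> M \<rightarrow>\<^sub>M S" "t \<in> M \<rightarrow>\<^sub>M S"
  shows "(\<lambda>x. \<gamma> (f x) (t x)) \<in> borel_measurable M"
  using measurable_comp[OF measurable_Pair[OF assms] \<gamma>_measurable] by (simp add: comp_def)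

text \<open>\<open>occ s n\<close> is \<open>\<mu>\<^sub>s(B\<^sub>n)\<close>.\<close>

definition occ :: "'s \<Rightarrow> nat \<Rightarrow> ennreal" where
  "occ s n = (\<integral>\<^sup>+ h. indicator (B n) (act h s) \<partial>lam)"

lemma measurable_occ [measurable]: "(\<lambda>s. occ s n) \<in> borel_measurable S"
  unfolding occ_def by measurable

lemma occ_finite: "s \<in> space S \<Longrightarrow> occ s n < \<infinity>"
proof -
  assume [measurable]: "s \<in> space S"
  have "emeasure (orbit_measure lam act S s) (B n) = (\<integral>\<^sup>+ t. indicator (B n) t \<partial>orbit_measure lam act S s)"
    by (simp add: orbit_measure_def)
  also have "\<dots> = occ s n"
    unfolding orbit_measure_def occ_def by (subst nn_integral_distr) auto
  finally show ?thesis using B_finite[of s n] \<open>s \<in> space S\<close> by simp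
qed

text \<open>The modular factor enters as a hypothesis, so that one \<open>c\<close> serves all
  \<open>n\<close> and any other integral in the same argument.\<close>

lemma occ_translate:
  assumes "\<And>f. f \<in> borel_measurable borel \<Longrightarrow> (\<integral>\<^sup>+ x. f (x + a) \<partial>lam) = c * (\<integral>\<^sup>+ x. f x \<partial>lam)"
    and s [measurable]: "s \<in> space S"
  shows "occ (act a s) n = c * occ s n"
proof -
  have "occ (act a s) n = (\<integral>\<^sup>+ h. indicator (B n) (act (h + a) s) \<partial>lam)"
    unfolding occ_def using s by (simp add: act_add)
  also have "\<dots> = c * occ s n"
    unfolding occ_def by (rule assms(1)) measurable
  finally show ?thesis .
qed

section \<open>Choosing and normalizing a set of positive finite orbit measure\<close>

definition idx :: "'s \<Rightarrow> nat" where "idx s = (LEAST n. occ s n \<noteq> 0)"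

lemma measurable_idx [measurable]: "idx \<in> S \<rightarrow>\<^sub>M count_space UNIV"
  unfolding idx_def by measurable

text \<open>Otherwise the sets of \<open>h\<close> with \<open>act h s\<close> in \<open>B n\<close>
  would be countably many null sets covering the group. In particular the \<open>LEAST\<close> in
  \<open>idx\<close> is attained.\<close>

lemma occ_idx:
  assumes s [measurable]: "s \<in> space S"
  shows "occ s (idx s) \<noteq> 0"
proof -
  have "\<exists>n. occ s n \<noteq> 0"
  proof (rule ccontr)
    assume "\<nexists>n. occ s n \<noteq> 0"
    then have "AE h in lam. indicator (B n) (act h s) = (0::ennreal)" for n
      unfolding occ_def by (subst nn_integral_0_iff_AE[symmetric]) auto
    then have "AE h in lam. \<forall>n. indicator (B n) (act h s) = (0::ennreal)"
      by (simp add: AE_all_countable)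
    then have "AE h in lam. False"
    proof eventually_elim
      case (elim h)
      have "act h s \<in> (\<Union>n. B n)" using B_cover s by simp
      then show ?case using elim by (auto simp: indicator_def split: if_splits)
    qed
    then have "emeasure lam UNIV = 0" by (simp add: AE_iff_measurable[OF _ refl])
    then show False using left_haar_measureD(3)[OF haar, of UNIV] by simp
  qed
  then show ?thesis unfolding idx_def by (rule LeastI_ex)
qed

text \<open>Moving along an orbit multiplies all values \<open>occ s n\<close> by one nonzero
  constant, so the same indices give zero.\<close>

lemma idx_act:
  assumes s: "s \<in> space S" shows "idx (act a s) = idx s"
proof -
  obtain c :: ennreal where c: "0 < c"
    "\<And>f. f \<in> borel_measurable borel \<Longrightarrow> (\<integral>\<^sup>+ x. f (x + a) \<partial>lam) = c * (\<integral>\<^sup>+ x. f x \<partial>lam)"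
    using nn_integral_right_translate[OF lc haar] by metis
  then have "occ (act a s) n \<noteq> 0 \<longleftrightarrow> occ s n \<noteq> 0" for n
    using occ_translate[OF c(2) s] by auto
  then show ?thesis by (simp add: idx_def)
qed

text \<open>The compactness of stabilizers enters only through this unimodularity.\<close>

lemma nn_integral_stabilizer_translate:
  assumes s: "s \<in> space S" "act k s = s" and f: "f \<in> borel_measurable borel"
  shows "(\<integral>\<^sup>+ x. f (x + k) \<partial>lam) = (\<integral>\<^sup>+ x. f x \<partial>lam)"
proof -
  obtain c :: ennreal where c: "0 < c"
    "\<And>f. f \<in> borel_measurable borel \<Longrightarrow> (\<integral>\<^sup>+ x. f (x + k) \<partial>lam) = c * (\<integral>\<^sup>+ x. f x \<partial>lam)"
    using nn_integral_right_translate[OF lc haar] by metis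
  define m where "m = occ s (idx s)"
  have m: "m \<noteq> 0" "m \<noteq> top" using occ_idx[OF s(1)] occ_finite[OF s(1), of "idx s"] by (auto simp: m_def)
  \<comment> \<open>Since \<open>k\<close> fixes \<open>s\<close>, translation by \<open>k\<close>
    leaves the orbit measure of the chosen set unchanged. That measure is neither zero nor infinite,
    so the modular factor is 1.\<close>
  have "c * m = m" using occ_translate[OF c(2) s(1)] s(2) by (simp add: m_def)
  then have "c = m / m" using m by (metis ennreal_mult_divide_eq)
  then have "c = 1" using m by (simp add: ennreal_divide_self less_top)
  then show ?thesis using c(2)[OF f] by simp
qed

definition wt :: "'s \<Rightarrow> 'g \<Rightarrow> ennreal" where
  "wt t h = indicator (B (idx t)) (act h t) / occ t (idx t)"

lemma measurable_wt [measurable (raw)]: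
  assumes f [measurable]: "f \<in> borel_measurable M" and t [measurable]: "t \<in> M \<rightarrow>\<^sub>M S"
  shows "(\<lambda>x. wt (t x) (f x)) \<in> borel_measurable M"
proof -
  \<comment> \<open>Since \<open>idx\<close> is measurable with countable range, it is enough to
    treat a fixed index.\<close>
  have "(\<lambda>x. (indicator (B n) (act (f x) (t x)) :: ennreal) / occ (t x) n) \<in> borel_measurable M" for n
    by measurable
  then show ?thesis
    unfolding wt_def by (rule measurable_compose_countable) measurable
qed

lemma nn_integral_wt:
  assumes t [measurable]: "t \<in> space S"
  shows "(\<integral>\<^sup>+ h. wt t h \<partial>lam) = 1"
proof -
  have "(\<integral>\<^sup>+ h. wt t h \<partial>lam) = occ t (idx t) / occ t (idx t)"
    unfolding wt_def by (subst nn_integral_divide) (auto simp: occ_def)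
  then show ?thesis
    using occ_idx[OF t] occ_finite[OF t, of "idx t"] by (simp add: ennreal_divide_self)
qed

text \<open>If \<open>t\<close> is in the orbit of \<open>s\<close>, then
  \<open>\<gamma> s (act h t)\<close> carries \<open>s\<close> to \<open>act h t\<close> and
  \<open>- h\<close> brings it back to \<open>t\<close>. Averaging over \<open>h\<close> removes the
  dependence of \<open>\<gamma>\<close> on the position of \<open>t\<close> in its orbit that would
  spoil equivariance. The null measure is a default outside \<open>space S\<close>.\<close>

definition kern :: "'s \<Rightarrow> 's \<Rightarrow> 'g measure" where
  "kern s t = (if s \<in> space S \<and> t \<in> space S
     then distr (density lam (wt t)) borel (\<lambda>h. - h + \<gamma> s (act h t)) else null_measure borel)"

lemma sets_kern [simp, measurable_cong]: "sets (kern s t) = sets borel"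
  by (simp add: kern_def)

lemma nn_integral_kern:
  assumes [measurable]: "s \<in> space S" "t \<in> space S" "f \<in> borel_measurable borel"
  shows "(\<integral>\<^sup>+ g. f g \<partial>kern s t) = (\<integral>\<^sup>+ h. wt t h * f (- h + \<gamma> s (act h t)) \<partial>lam)"
  using assms(1,2) by (simp add: kern_def nn_integral_distr nn_integral_density)

lemma emeasure_kern:
  assumes [measurable]: "s \<in> space S" "t \<in> space S" "A \<in> sets borel"
  shows "emeasure (kern s t) A = (\<integral>\<^sup>+ h. wt t h * indicator A (- h + \<gamma> s (act h t)) \<partial>lam)"
  using nn_integral_kern[of s t "indicator A"] assms by simp

lemma is_kernel_kern: "is_kernel S kern"
  unfolding is_kernel_def
proof (intro conjI allI ballI)
  fix A :: "'g set" assume [measurable]: "A \<in> sets borel"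
  have "(\<lambda>x. \<integral>\<^sup>+ h. wt (snd x) h * indicator A (- h + \<gamma> (fst x) (act h (snd x))) \<partial>lam)
      \<in> borel_measurable (S \<Otimes>\<^sub>M S)"
    by measurable
  then show "(\<lambda>(s, t). emeasure (kern s t) A) \<in> borel_measurable (S \<Otimes>\<^sub>M S)"
    by (rule measurable_cong[THEN iffD1, rotated]) (auto simp: space_pair_measure emeasure_kern)
qed simp

text \<open>Substitute \<open>h + a\<close> for \<open>h\<close>: the sampled element becomes
  \<open>a\<close> plus the one for \<open>t\<close>, and
  \<open>c * wt (act a t) h = wt t (h + a)\<close>. The modular factor of the substitution cancels
  this \<open>c\<close>, which is positive and finite.\<close>

lemma kern_act:
  assumes s [measurable]: "s \<in> space S" and t [measurable]: "t \<in> space S"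
  shows "kern s (act a t) = distr (kern s t) borel (\<lambda>h. a + h)"
proof (rule measure_eqI)
  obtain c :: ennreal where c: "0 < c" "c < \<infinity>"
    and shift: "\<And>f. f \<in> borel_measurable borel \<Longrightarrow> (\<integral>\<^sup>+ x. f (x + a) \<partial>lam) = c * (\<integral>\<^sup>+ x. f x \<partial>lam)"
    using nn_integral_right_translate[OF lc haar] by metis
  have occ_act: "occ (act a t) n = c * occ t n" for n
    by (rule occ_translate[OF shift t])
  have wt_act: "c * wt (act a t) h = wt t (h + a)" for h
  proof -
    define m where "m = occ t (idx t)"
    have "wt (act a t) h = indicator (B (idx t)) (act (h + a) t) / (c * m)"
      unfolding wt_def idx_act[OF t] occ_act m_def by (simp add: act_add t)
    moreover have "c * (x / (c * m)) = x / m" for x :: ennreal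
      using divide_mult_eq[of c x m] c by (simp add: ennreal_times_divide mult.commute)
    ultimately show ?thesis by (simp add: wt_def m_def)
  qed
  have c_cancel: "x = y" if "c * x = c * y" for x y :: ennreal
    using ennreal_mult_divide_eq[of c x] ennreal_mult_divide_eq[of c y] c that
    by (simp add: mult.commute)
  have undo: "a + (- (h + a) + g) = - h + g" for g h
    by (simp only: minus_add add.assoc[symmetric] right_minus add_0_left)
  fix A assume "A \<in> sets (kern s (act a t))"
  then have A [measurable]: "A \<in> sets borel" by simp
  have "c * emeasure (kern s (act a t)) A =
      c * (\<integral>\<^sup>+ h. wt (act a t) h * indicator A (- h + \<gamma> s (act h (act a t))) \<partial>lam)"
    by (subst emeasure_kern) (auto simp: s t)
  also have "\<dots> = (\<integral>\<^sup>+ h. c * (wt (act a t) h * indicator A (- h + \<gamma> s (act h (act a t)))) \<partial>lam)"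
    by (rule nn_integral_cmult[symmetric]) measurable
  also have "\<dots> = (\<integral>\<^sup>+ h. wt t (h + a) * indicator A (a + (- (h + a) + \<gamma> s (act (h + a) t))) \<partial>lam)"
    by (simp add: mult.assoc[symmetric] wt_act act_add t undo)
  also have "\<dots> = c * (\<integral>\<^sup>+ h. wt t h * indicator A (a + (- h + \<gamma> s (act h t))) \<partial>lam)"
    by (rule shift) measurable
  also have "(\<integral>\<^sup>+ h. wt t h * indicator A (a + (- h + \<gamma> s (act h t))) \<partial>lam) =
      (\<integral>\<^sup>+ g. indicator A (a + g) \<partial>kern s t)"
    by (subst nn_integral_kern) (auto simp: s t)
  also have "\<dots> = (\<integral>\<^sup>+ g. indicator A g \<partial>distr (kern s t) borel (\<lambda>h. a + h))"
    by (subst nn_integral_distr) auto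
  also have "\<dots> = emeasure (distr (kern s t) borel (\<lambda>h. a + h)) A" by simp
  finally show "emeasure (kern s (act a t)) A = emeasure (distr (kern s t) borel (\<lambda>h. a + h)) A"
    by (rule c_cancel)
qed simp

section \<open>Concentration, total mass and the disintegration formula\<close>

lemma act_kern_support:
  assumes s: "s \<in> space S"
  shows "act (- h + \<gamma> s (act h (act a s))) s = act a s"
  using s \<gamma>_transports[OF s, of "h + a"] by (simp add: act_add)

lemma AE_kern:
  assumes s [measurable]: "s \<in> space S"
  shows "AE g in kern s (act a s). act g s = act a s"
proof -
  obtain j :: "'s \<Rightarrow> real" where j [measurable]: "j \<in> S \<rightarrow>\<^sub>M borel" and j_inj: "inj_on j (space S)"
    using space_code by blast
  \<comment> \<open>An injective real code turns an equation in \<open>S\<close> into one between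
    real measurable functions, so the set is Borel.\<close>
  have "{g. act g s = act a s} = {g \<in> space borel. j (act g s) = j (act a s)}"
    using j_inj s by (auto dest: inj_onD)
  also have "\<dots> \<in> sets borel" by measurable
  finally have "{g \<in> space borel. act g s = act a s} \<in> sets borel" by simp
  then have "AE g in distr (density lam (wt (act a s))) borel (\<lambda>h. - h + \<gamma> s (act h (act a s))).
      act g s = act a s"
    by (subst AE_distr_iff) (auto simp: act_kern_support s)
  then show ?thesis using s unfolding kern_def by simp
qed

lemma emeasure_kern_space:
  assumes [measurable]: "s \<in> space S" "t \<in> space S"
  shows "emeasure (kern s t) (space (kern s t)) = 1"
proof -
  have "space (kern s t) = UNIV" using sets_eq_imp_space_eq[OF sets_kern] by simp
  then show ?thesis using nn_integral_wt assms by (simp add: emeasure_kern)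
qed

text \<open>Equivariance expresses the kernel at \<open>act b s\<close> as the translate by
  \<open>b\<close> of \<open>kern s s\<close>, which samples from the stabilizer of
  \<open>s\<close>. Right invariance of \<open>lam\<close> under stabilizer elements then removes
  the sampled element, and the weights integrate to 1.\<close>

lemma disintegration:
  assumes s [measurable]: "s \<in> space S" and f [measurable]: "f \<in> borel_measurable (S \<Otimes>\<^sub>M borel)"
  shows "(\<integral>\<^sup>+ g. f (act g s, g) \<partial>lam) =
    (\<integral>\<^sup>+ t. (\<integral>\<^sup>+ g. f (t, g) \<partial>kern s t) \<partial>orbit_measure lam act S s)"
proof -
  interpret pair_sigma_finite lam lam ..
  \<comment> \<open>The explicit integral formula provides measurability of the inner integral in
    \<open>t\<close>, needed to change variables to the group.\<close>
  have "(\<lambda>t. \<integral>\<^sup>+ h. wt t h * f (t, - h + \<gamma> s (act h t)) \<partial>lam) \<in> borel_measurable S"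
    by measurable
  then have [measurable]: "(\<lambda>t. \<integral>\<^sup>+ g. f (t, g) \<partial>kern s t) \<in> borel_measurable S"
    by (rule measurable_cong[THEN iffD1, rotated])
      (intro nn_integral_kern[symmetric] s, measurable)
  have "(\<integral>\<^sup>+ t. (\<integral>\<^sup>+ g. f (t, g) \<partial>kern s t) \<partial>orbit_measure lam act S s) =
      (\<integral>\<^sup>+ b. (\<integral>\<^sup>+ g. f (act b s, g) \<partial>kern s (act b s)) \<partial>lam)"
    unfolding orbit_measure_def by (rule nn_integral_distr) measurable
  also have "\<dots> = (\<integral>\<^sup>+ b. (\<integral>\<^sup>+ g. f (act b s, b + g) \<partial>kern s s) \<partial>lam)"
    by (simp add: kern_act nn_integral_distr s)
  also have "\<dots> = (\<integral>\<^sup>+ b. (\<integral>\<^sup>+ h. wt s h * f (act b s, b + (- h + \<gamma> s (act h s))) \<partial>lam) \<partial>lam)"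
    by (intro nn_integral_cong nn_integral_kern) measurable
  \<comment> \<open>With \<open>b\<close> innermost, the element
    \<open>- h + \<gamma> s (act h s)\<close> is fixed during the integration over \<open>b\<close>
    and acts as a constant right translation.\<close>
  also have "\<dots> = (\<integral>\<^sup>+ h. (\<integral>\<^sup>+ b. wt s h * f (act b s, b + (- h + \<gamma> s (act h s))) \<partial>lam) \<partial>lam)"
    by (rule Fubini') measurable
  also have "\<dots> = (\<integral>\<^sup>+ h. wt s h * (\<integral>\<^sup>+ b. f (act b s, b) \<partial>lam) \<partial>lam)"
  proof (rule nn_integral_cong)
    fix h
    define k where "k = - h + \<gamma> s (act h s)"
    \<comment> \<open>The case \<open>a = 0\<close> of the support lemma shows that the sampled
      element fixes \<open>s\<close>, so \<open>b\<close> and \<open>b + k\<close> send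
      \<open>s\<close> to the same point.\<close>
    have k: "act k s = s" using act_kern_support[OF s, of h 0] s by (simp add: k_def)
    have "(\<integral>\<^sup>+ b. f (act b s, b + k) \<partial>lam) = (\<integral>\<^sup>+ b. f (act (b + k) s, b + k) \<partial>lam)"
      using s by (simp add: act_add k)
    also have "\<dots> = (\<integral>\<^sup>+ b. f (act b s, b) \<partial>lam)"
      by (rule nn_integral_stabilizer_translate[OF s k]) measurable
    finally have "(\<integral>\<^sup>+ b. f (act b s, b + k) \<partial>lam) = (\<integral>\<^sup>+ b. f (act b s, b) \<partial>lam)" .
    then show "(\<integral>\<^sup>+ b. wt s h * f (act b s, b + (- h + \<gamma> s (act h s))) \<partial>lam) =
        wt s h * (\<integral>\<^sup>+ b. f (act b s, b) \<partial>lam)"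
      unfolding k_def[symmetric] by (subst nn_integral_cmult) auto
  qed
  also have "\<dots> = (\<integral>\<^sup>+ b. f (act b s, b) \<partial>lam)"
    by (simp add: nn_integral_multc nn_integral_wt s)
  finally show ?thesis ..
qed

end

theorem theorem2p1:
  fixes lam :: "'g::{topological_group_add, t2_space, second_countable_topology} measure"
    and S :: "'s measure"
    and act :: "'g \<Rightarrow> 's \<Rightarrow> 's"
  assumes "locally_compact_space (euclidean :: 'g topology)"
    and "left_haar_measure lam"
    and "borel_space_iso S"
    and "measurable_action act S"
    and "proper_action lam act S"
  shows "\<exists>\<kappa> :: 's \<Rightarrow> 's \<Rightarrow> 'g measure. is_kernel S \<kappa> \<and>
    (\<forall>s\<in>space S. \<forall>f \<in> borel_measurable (S \<Otimes>\<^sub>M (borel :: 'g measure)).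
       (\<integral>\<^sup>+ g. f (act g s, g) \<partial>lam) =
       (\<integral>\<^sup>+ t. (\<integral>\<^sup>+ g. f (t, g) \<partial>\<kappa> s t) \<partial>orbit_measure lam act S s)) \<and>
    (\<forall>g. \<forall>s\<in>space S. \<forall>t\<in>space S. \<kappa> s (act g t) = distr (\<kappa> s t) borel (\<lambda>h. g + h)) \<and>
    (\<forall>s\<in>space S. \<forall>t\<in>space S. (\<exists>g. t = act g s) \<longrightarrow> (AE g in \<kappa> s t. act g s = t)) \<and>
    (\<forall>s\<in>space S. \<forall>t\<in>space S. (\<exists>g. t = act g s) \<longrightarrow> emeasure (\<kappa> s t) (space (\<kappa> s t)) = 1)"
proof -
  interpret borel_action lam S act
    by unfold_locales (fact assms)+
  obtain B :: "nat \<Rightarrow> 's set" where "(\<forall>n. B n \<in> sets S) \<and> disjoint_family B \<and>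
      (\<Union>n. B n) = space S \<and>
      (\<forall>s\<in>space S. \<forall>n. emeasure (orbit_measure lam act S s) (B n) < \<infinity>)"
    using assms(5) unfolding proper_action_def by (rule exE)
  then have B: "\<And>n. B n \<in> sets S" "(\<Union>n. B n) = space S"
    "\<And>s n. s \<in> space S \<Longrightarrow> emeasure (orbit_measure lam act S s) (B n) < \<infinity>"
    by simp_all
  obtain \<gamma> where \<gamma>: "(\<lambda>(s, t). \<gamma> s t) \<in> borel_measurable (S \<Otimes>\<^sub>M S)"
    "\<And>s g. s \<in> space S \<Longrightarrow> act (\<gamma> s (act g s)) s = act g s"
    using measurable_transporter by metis
  interpret transported_action lam S act B \<gamma>
    by unfold_locales (fact B \<gamma>)+
  show ?thesis
  proof (intro exI[of _ kern] conjI ballI allI impI)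
    fix s t assume s: "s \<in> space S" and "t \<in> space S" and "\<exists>g. t = act g s"
    then obtain g where t: "t = act g s" by blast
    show "AE g in kern s t. act g s = t" unfolding t by (rule AE_kern[OF s])
  qed (fact is_kernel_kern disintegration kern_act | rule emeasure_kern_space, assumption+)+
qed

end
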